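(* Let $p$ be a prime, $s\ge 1$, and let $(\Gamma,\mathbf k)$ be a negative color scheme with $\Gamma$ connected and $(\Gamma,\mathbf k)$ $\mathbf Z/p^s$-reduced. If $\Gamma$ is bipartite, then (the reduction modulo $p^s$ of) the divided fundamental class $\mathcal{D}iv\{\Gamma,\mathbf k\}$ is a $\mathbf Z/p^s$-orientation class of $(\Gamma,\mathbf k)$. If $p$ is odd and $\Gamma$ is not bipartite, then $(\Gamma,\mathbf k)$ is not $\mathbf Z/p^s$-oriented.
   Context: Graphs are finite, without loops or multiple edges; $V(\Gamma)$, $E(\Gamma)$ denote vertices and edges and $e(v,w)$ the edge joining $v,w$. A negative color scheme $(\Gamma,\mathbf k)$ is a graph $\Gamma$ with a positive integer $k_v$ for each vertex $v$. Its cochain complex $C^*(\Gamma,\mathbf k)$ has $C^0=\mathbf Z[V(\Gamma)]$, $C^1=\mathbf Z[E(\Gamma)]$, and only nontrivial differential $d^0(v)=\sum_{w} k_w\, e(v,w)$, the sum over neighbours $w$ of $v$. $H^*(\Gamma,\mathbf k;R)$ is the cohomology of $C^*(\Gamma,\mathbf k)\otimes R$; in particular $H^0(\Gamma,\mathbf k;R)\subset C^0(\Gamma,\mathbf k;R)$ is the group of cocycles. $\mathbf Z/p^s$-reduced: there is no edge $e(v,w)$ with $k_vk_w=0$ in $\mathbf Z/p^s$. Let $i:\mathbf Z/p^{s-1}\to\mathbf Z/p^s$ be $i(x)=px$. The critical cohomology $\mathcal{CR}(\Gamma,\mathbf k;\mathbf Z/p^s)$ is the cokernel of $i_*:H^0(\Gamma,\mathbf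 k;\mathbf Z/p^{s-1})\to H^0(\Gamma,\mathbf k;\mathbf Z/p^s)$. A connected $(\Gamma,\mathbf k)$ is $\mathbf Z/p^s$-oriented (orientable) if $\mathcal{CR}(\Gamma,\mathbf k;\mathbf Z/p^s)\cong\mathbf Z/p$; a $\mathbf Z/p^s$-orientation class is then an element of $H^0(\Gamma,\mathbf k;\mathbf Z/p^s)$ mapping to a generator of $\mathcal{CR}(\Gamma,\mathbf k;\mathbf Z/p^s)$. A bipartitioning of $\Gamma$ is a map $\alpha:V(\Gamma)\to\{\pm1\}$ taking different values at the two endpoints of every edge; $\Gamma$ is bipartite if one exists. For $\Gamma$ connected bipartite with bipartitioning $\alpha$ (unique up to sign), $\mathcal{D}iv\{\Gamma,\mathbf k\}=\frac1{\mathrm{GCD}(\mathbf k)}\sum_{v}\alpha(v)k_v\,v\in C^0(\Gamma,\mathbf k)$, where $\mathrm{GCD}(\mathbf k)$ is the greatest common divisor of all $k_v$. *)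

theory Defs
  imports "HOL-Algebra.Algebra" "HOL-Number_Theory.Cong"
begin

definition finite_simple_graph :: "'a set \<Rightarrow> 'a set set \<Rightarrow> bool" where
  "finite_simple_graph V E \<longleftrightarrow>
     finite V \<and> (\<forall>e\<in>E. \<exists>v\<in>V. \<exists>w\<in>V. v \<noteq> w \<and> e = {v, w})"

definition connected_graph :: "'a set \<Rightarrow> 'a set set \<Rightarrow> bool" where
  "connected_graph V E \<longleftrightarrow>
     V \<noteq> {} \<and> (\<forall>v\<in>V. \<forall>w\<in>V. (v, w) \<in> {(a, b). {a, b} \<in> E}\<^sup>*)"

definition bipartitioning :: "'a set \<Rightarrow> 'a set set \<Rightarrow> ('a \<Rightarrow> int) \<Rightarrow> bool" where
  "bipartitioning V E \<alpha> \<longleftrightarrow>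
     \<alpha> \<in> V \<rightarrow> {1, - 1} \<and> (\<forall>v w. {v, w} \<in> E \<longrightarrow> \<alpha> v \<noteq> \<alpha> w)"

definition bipartite :: "'a set \<Rightarrow> 'a set set \<Rightarrow> bool" where
  "bipartite V E \<longleftrightarrow> (\<exists>\<alpha>. bipartitioning V E \<alpha>)"

definition negative_color_scheme :: "'a set \<Rightarrow> 'a set set \<Rightarrow> ('a \<Rightarrow> nat) \<Rightarrow> bool" where
  "negative_color_scheme V E k \<longleftrightarrow> finite_simple_graph V E \<and> (\<forall>v\<in>V. 0 < k v)"

definition mod_reduced :: "'a set set \<Rightarrow> ('a \<Rightarrow> nat) \<Rightarrow> nat \<Rightarrow> bool" where
  "mod_reduced E k n \<longleftrightarrow> (\<forall>v w. {v, w} \<in> E \<longrightarrow> \<not> [k v * k w = 0] (mod n))"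

text \<open>
  Coefficients are taken in an abelian group \<open>R\<close>, written multiplicatively as everywhere in
  HOL-Algebra, so that \<open>x [^]\<^bsub>R\<^esub> m\<close> is the multiple \<open>m x\<close>.  Since the graph is finite, the
  group \<open>\<int>[V] \<otimes> R\<close> is the group of functions from \<open>V\<close> to \<open>R\<close>: the function \<open>x\<close> stands for
  the formal sum of the \<open>x v \<cdot> v\<close>.  The same holds for \<open>\<int>[E] \<otimes> R\<close>.
\<close>

definition cochains0 :: "'a set \<Rightarrow> ('r, 'm) monoid_scheme \<Rightarrow> ('a \<Rightarrow> 'r) monoid" where
  "cochains0 V R = product_group V (\<lambda>_. R)"

definition cochains1 :: "'a set set \<Rightarrow> ('r, 'm) monoid_scheme \<Rightarrow> ('a set \<Rightarrow> 'r) monoid" where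
  "cochains1 E R = product_group E (\<lambda>_. R)"

text \<open>
  The linear extension of \<open>d v = \<Sum>\<^sub>w k w \<cdot> {v, w}\<close>, with \<open>w\<close> running over the neighbours
  of \<open>v\<close>: the coefficient at \<open>e\<close> collects the terms \<open>k w \<cdot> x v\<close> with \<open>{v, w} = e\<close>.
\<close>

definition differential0 ::
    "'a set \<Rightarrow> 'a set set \<Rightarrow> ('a \<Rightarrow> nat) \<Rightarrow> ('r, 'm) monoid_scheme \<Rightarrow> ('a \<Rightarrow> 'r) \<Rightarrow> ('a set \<Rightarrow> 'r)" where
  "differential0 V E k R x =
     (\<lambda>e\<in>E. finprod R (\<lambda>(v, w). x v [^]\<^bsub>R\<^esub> k w) {(v, w). v \<in> V \<and> w \<in> V \<and> {v, w} = e})"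

definition cohomology0 ::
    "'a set \<Rightarrow> 'a set set \<Rightarrow> ('a \<Rightarrow> nat) \<Rightarrow> ('r, 'm) monoid_scheme \<Rightarrow> ('a \<Rightarrow> 'r) monoid" where
  "cohomology0 V E k R =
     (cochains0 V R)\<lparr>carrier := kernel (cochains0 V R) (cochains1 E R) (differential0 V E k R)\<rparr>"

text \<open>
  The map \<open>i\<close> from \<open>\<int>/p\<^sup>s\<^sup>-\<^sup>1\<close> to \<open>\<int>/p\<^sup>s\<close> on standard representatives (it is only used
  for \<open>1 \<le> s\<close>; for \<open>s = 1\<close> its source is the trivial group \<open>integer_mod_group 1\<close>), and the
  image of \<open>i\<^sub>*\<close> on \<open>0\<close>-dimensional cohomology.
\<close>

definition coeff_incl :: "nat \<Rightarrow> nat \<Rightarrow> int \<Rightarrow> int" where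
  "coeff_incl p s x = (int p * x) mod int (p ^ s)"

definition coeff_incl_image ::
    "'a set \<Rightarrow> 'a set set \<Rightarrow> ('a \<Rightarrow> nat) \<Rightarrow> nat \<Rightarrow> nat \<Rightarrow> ('a \<Rightarrow> int) set" where
  "coeff_incl_image V E k p s =
     compose V (coeff_incl p s) ` carrier (cohomology0 V E k (integer_mod_group (p ^ (s - 1))))"

definition critical_cohomology ::
    "'a set \<Rightarrow> 'a set set \<Rightarrow> ('a \<Rightarrow> nat) \<Rightarrow> nat \<Rightarrow> nat \<Rightarrow> ('a \<Rightarrow> int) set monoid" where
  "critical_cohomology V E k p s =
     cohomology0 V E k (integer_mod_group (p ^ s)) Mod coeff_incl_image V E k p s"

definition mod_oriented :: "'a set \<Rightarrow> 'a set set \<Rightarrow> ('a \<Rightarrow> nat) \<Rightarrow> nat \<Rightarrow> nat \<Rightarrow> bool" where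
  "mod_oriented V E k p s \<longleftrightarrow>
     connected_graph V E \<and> critical_cohomology V E k p s \<cong> integer_mod_group p"

definition orientation_class ::
    "'a set \<Rightarrow> 'a set set \<Rightarrow> ('a \<Rightarrow> nat) \<Rightarrow> nat \<Rightarrow> nat \<Rightarrow> ('a \<Rightarrow> int) \<Rightarrow> bool" where
  "orientation_class V E k p s c \<longleftrightarrow>
     mod_oriented V E k p s \<and>
     c \<in> carrier (cohomology0 V E k (integer_mod_group (p ^ s))) \<and>
     generate (critical_cohomology V E k p s)
       {coeff_incl_image V E k p s #>\<^bsub>cohomology0 V E k (integer_mod_group (p ^ s))\<^esub> c}
     = carrier (critical_cohomology V E k p s)"

text \<open>An element of the integral cochain group \<open>cochains0 V integer_group\<close>; the division is exact.\<close>

definition divided_fundamental_class :: "'a set \<Rightarrow> ('a \<Rightarrow> nat) \<Rightarrow> ('a \<Rightarrow> int) \<Rightarrow> ('a \<Rightarrow> int)" where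
  "divided_fundamental_class V k \<alpha> = (\<lambda>v\<in>V. (\<alpha> v * int (k v)) div int (Gcd (k ` V)))"

definition reduce_cochain :: "'a set \<Rightarrow> nat \<Rightarrow> ('a \<Rightarrow> int) \<Rightarrow> ('a \<Rightarrow> int)" where
  "reduce_cochain V n = compose V (\<lambda>x. x mod int n)"

end

theory Submission
  imports Defs
begin

text \<open>
  A cocycle \<open>x\<close> satisfies \<open>k w * x v + k v * x w \<equiv> 0 (mod p^s)\<close> on every edge.  Dividing by
  \<open>k v * k w\<close>, which is not divisible by \<open>p^s\<close> because the scheme is reduced, shows that the ratios
  \<open>y v = x v / k v\<close> satisfy \<open>y v + y w \<equiv> 0\<close> modulo the maximal ideal of the local ring of \<open>\<rat>\<close>
  at \<open>p\<close>, although the ratios need not lie in that ring.  Such congruences compose along paths: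
  in a connected graph \<open>y v \<equiv> \<plusminus> y w\<close> for all \<open>v\<close> and \<open>w\<close>
  (lemmas \<open>signed_ratio_cong_edge\<close>, \<open>signed_ratio_cong_trans\<close>).

  The image of \<open>i\<^sub>*\<close> consists of the cocycles all of whose values are divisible by \<open>p\<close>
  (\<open>coeff_incl_image_eq\<close>), so the critical cohomology records a cocycle modulo \<open>p\<close>.

  If \<open>\<Gamma>\<close> is bipartite, take a vertex \<open>w\<close> at which \<open>k w / Gcd (k ` V)\<close> is prime to \<open>p\<close>.
  The relation \<open>y v \<equiv> \<plusminus> y w\<close> shows that a cocycle vanishing modulo \<open>p\<close> at \<open>w\<close> vanishes modulo \<open>p\<close>
  everywhere (\<open>cocycle_dvd_everywhere\<close>).  Hence evaluation at \<open>w\<close> modulo \<open>p\<close> has the image of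
  \<open>i\<^sub>*\<close> as its kernel, and the divided fundamental class takes a unit value at \<open>w\<close>; the first
  isomorphism theorem finishes this case.

  If some cocycle has a value \<open>x u\<close> prime to \<open>p\<close> and \<open>p\<close> is odd, then \<open>y u \<equiv> y v\<close> and
  \<open>y u \<equiv> - y v\<close> cannot both hold, and the sign that does hold is a bipartitioning
  (\<open>bipartite_if_cocycle_not_dvd\<close>).  So for \<open>\<Gamma>\<close> not bipartite the critical cohomology is trivial.
\<close>

section \<open>Zero-dimensional cohomology with cyclic coefficients\<close>

lemma edge_vertices:
  assumes "finite_simple_graph V E" "{v, w} \<in> E"
  shows "v \<in> V" "w \<in> V" "v \<noteq> w"
  using assms by (auto simp: finite_simple_graph_def doubleton_eq_iff)

lemma differential0_edge:
  assumes "finite_simple_graph V E" "{v, w} \<in> E" "x \<in> V \<rightarrow>\<^sub>E {0..<int n}" "0 < n"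
  shows "differential0 V E k (integer_mod_group n) x {v, w}
         = (int (k w) * x v + int (k v) * x w) mod int n"
proof -
  interpret comm_group "integer_mod_group n" by simp
  note vw = edge_vertices[OF assms(1,2)]
  have pairs: "{(a, b). a \<in> V \<and> b \<in> V \<and> {a, b} = {v, w}} = {(v, w), (w, v)}"
    using vw by (auto simp: doubleton_eq_iff)
  have "x v \<in> carrier (integer_mod_group n)" "x w \<in> carrier (integer_mod_group n)"
    using assms(3,4) vw by (auto simp: carrier_integer_mod_group)
  moreover from this have "x v [^]\<^bsub>integer_mod_group n\<^esub> k w \<in> carrier (integer_mod_group n)"
    "x w [^]\<^bsub>integer_mod_group n\<^esub> k v \<in> carrier (integer_mod_group n)"
    by (blast intro: nat_pow_closed)+
  ultimately show ?thesis
    using vw assms(2)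
    by (simp add: differential0_def pairs finprod_insert mod_add_eq)
qed

lemma dvd_linear_mod_iff:
  "int n dvd a * (x mod int n) + b * (y mod int n) \<longleftrightarrow> int n dvd a * x + b * y"
proof -
  have "[a * (x mod int n) + b * (y mod int n) = a * x + b * y] (mod int n)"
    by (intro cong_add cong_scalar_left) simp_all
  then show ?thesis by (rule cong_dvd_iff)
qed

lemma carrier_cohomology0:
  assumes "finite_simple_graph V E" "0 < n"
  shows "carrier (cohomology0 V E k (integer_mod_group n)) =
    {x \<in> V \<rightarrow>\<^sub>E {0..<int n}. \<forall>v w. {v, w} \<in> E \<longrightarrow> int n dvd int (k w) * x v + int (k v) * x w}"
    (is "?L = ?R")
proof -
  have "differential0 V E k (integer_mod_group n) x = (\<lambda>e\<in>E. 0) \<longleftrightarrow>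
        (\<forall>v w. {v, w} \<in> E \<longrightarrow> int n dvd int (k w) * x v + int (k v) * x w)"
    (is "?D = _ \<longleftrightarrow> _") if x: "x \<in> V \<rightarrow>\<^sub>E {0..<int n}" for x
  proof -
    have "?D = (\<lambda>e\<in>E. 0) \<longleftrightarrow> (\<forall>e\<in>E. ?D e = 0)"
      by (auto simp: differential0_def fun_eq_iff)
    also have "\<dots> \<longleftrightarrow> (\<forall>v w. {v, w} \<in> E \<longrightarrow> ?D {v, w} = 0)"
      using assms(1) unfolding finite_simple_graph_def by metis
    finally show ?thesis
      using differential0_edge[OF assms(1) _ x assms(2)] by (simp add: dvd_eq_mod_eq_0)
  qed
  then show ?thesis
    using assms(2)
    by (auto simp: cohomology0_def kernel_def cochains0_def cochains1_def
        carrier_integer_mod_group)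
qed

lemma mult_cohomology0 [simp]:
  "x \<otimes>\<^bsub>cohomology0 V E k (integer_mod_group n)\<^esub> y = (\<lambda>v\<in>V. (x v + y v) mod int n)"
  by (simp add: cohomology0_def cochains0_def)

lemma group_cohomology0:
  assumes "finite_simple_graph V E" "0 < n"
  shows "group (cohomology0 V E k (integer_mod_group n))"
proof -
  let ?Z = "integer_mod_group n"
  let ?H = "carrier (cohomology0 V E k ?Z)"
  have grp: "group (cochains0 V ?Z)" by (simp add: cochains0_def)
  note H = carrier_cohomology0[OF assms]
  have "subgroup ?H (cochains0 V ?Z)"
  proof (rule group.subgroupI[OF grp])
    show "?H \<subseteq> carrier (cochains0 V ?Z)" "?H \<noteq> {}"
      unfolding cohomology0_def using assms edge_vertices[OF assms(1)] H[of k]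
      by (auto simp: kernel_def cohomology0_def intro!: exI[of _ "\<lambda>v\<in>V. 0"])
  next
    fix x assume x: "x \<in> ?H"
    have eq: "inv\<^bsub>cochains0 V ?Z\<^esub> x = (\<lambda>v\<in>V. - x v mod int n)"
    proof -
      have x': "x \<in> (\<Pi>\<^sub>E v\<in>V. carrier ?Z)"
        using x assms(2) by (simp add: H carrier_integer_mod_group)
      show ?thesis unfolding cochains0_def inv_product_group[OF x' group_integer_mod_group]
        using x' by (intro restrict_ext) (auto intro!: inv_integer_mod_group)
    qed
    have "int n dvd int (k w) * (- x v mod int n) + int (k v) * (- x w mod int n)"
      if "{v, w} \<in> E" for v w
    proof -
      have "int n dvd - (int (k w) * x v + int (k v) * x w)"
        using x that unfolding H dvd_minus_iff by blast
      then show ?thesis by (simp add: dvd_linear_mod_iff)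
    qed
    then show "inv\<^bsub>cochains0 V ?Z\<^esub> x \<in> ?H"
      using assms(2) edge_vertices[OF assms(1)] by (auto simp: eq H)
  next
    fix x y assume xy: "x \<in> ?H" "y \<in> ?H"
    have eq: "x \<otimes>\<^bsub>cochains0 V ?Z\<^esub> y = (\<lambda>v\<in>V. (x v + y v) mod int n)"
      by (simp add: cochains0_def)
    have "int n dvd int (k w) * ((x v + y v) mod int n) + int (k v) * ((x w + y w) mod int n)"
      if "{v, w} \<in> E" for v w
    proof -
      have "int n dvd (int (k w) * x v + int (k v) * x w) + (int (k w) * y v + int (k v) * y w)"
        using xy that unfolding H by (blast intro: dvd_add)
      then show ?thesis unfolding dvd_linear_mod_iff by (simp add: algebra_simps)
    qed
    then show "x \<otimes>\<^bsub>cochains0 V ?Z\<^esub> y \<in> ?H"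
      using assms(2) edge_vertices[OF assms(1)] by (auto simp: eq H)
  qed
  then have "group (cochains0 V ?Z\<lparr>carrier := ?H\<rparr>)"
    using grp by (rule subgroup.subgroup_is_group)
  then show ?thesis by (simp add: cohomology0_def)
qed

text \<open>
  Division by \<open>p\<close> turns a cocycle modulo \<open>p^s\<close> with values divisible by \<open>p\<close> into a cocycle modulo
  \<open>p^(s-1)\<close>, since the cocycle condition is linear in \<open>x\<close>.
\<close>

lemma coeff_incl_image_eq:
  assumes "finite_simple_graph V E" "0 < p" "1 \<le> s"
  shows "coeff_incl_image V E k p s =
    {x \<in> carrier (cohomology0 V E k (integer_mod_group (p ^ s))). \<forall>v\<in>V. int p dvd x v}"
    (is "?I = ?R")
proof -
  obtain t where s: "s = Suc t" using assms(3) by (cases s) auto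
  have n: "0 < p ^ s" "0 < p ^ t" using assms(2) by auto
  note H = carrier_cohomology0[OF assms(1) n(1)] carrier_cohomology0[OF assms(1) n(2)]
  let ?H = "carrier (cohomology0 V E k (integer_mod_group (p ^ t)))"
  have incl: "coeff_incl p s a = int p * a" if "a \<in> {0..<int (p ^ t)}" for a
    using that assms(2) by (simp add: coeff_incl_def s)
  have scale: "int (p ^ s) dvd int (k w) * (int p * a) + int (k v) * (int p * b)
      \<longleftrightarrow> int (p ^ t) dvd int (k w) * a + int (k v) * b" for v w a b
  proof -
    have "int (k w) * (int p * a) + int (k v) * (int p * b)
        = int p * (int (k w) * a + int (k v) * b)" by (simp add: algebra_simps)
    then show ?thesis using assms(2) by (simp add: s)
  qed
  show ?thesis
  proof (intro equalityI subsetI)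
    fix y assume "y \<in> ?I"
    then obtain x where x: "x \<in> ?H" and "y = compose V (coeff_incl p s) x"
      by (auto simp: coeff_incl_image_def s)
    moreover have "coeff_incl p s (x v) = int p * x v" if "v \<in> V" for v
      using x that unfolding H by (intro incl) auto
    ultimately have y: "y = (\<lambda>v\<in>V. int p * x v)"
      by (auto simp: compose_def intro!: restrict_ext)
    have "y \<in> V \<rightarrow>\<^sub>E {0..<int (p ^ s)}"
      using x assms(2) unfolding y H by (auto simp: s PiE_iff)
    then show "y \<in> ?R"
      using x edge_vertices[OF assms(1)] unfolding H by (auto simp: y scale simp del: of_nat_power)
  next
    fix y assume y: "y \<in> ?R"
    define x where "x = (\<lambda>v\<in>V. y v div int p)"
    have yx: "y v = int p * x v" if "v \<in> V" for v
      using y that by (simp add: x_def)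
    have yr: "0 \<le> y v" "y v < int p * int p ^ t" if "v \<in> V" for v
      using y that unfolding H by (auto simp: PiE_iff s)
    have x_range: "x v \<in> {0..<int (p ^ t)}" if "v \<in> V" for v
      using yr[OF that] assms(2) by (simp add: yx[OF that] zero_le_mult_iff)
    have "x \<in> ?H"
    proof -
      have "int (p ^ t) dvd int (k w) * x v + int (k v) * x w" if "{v, w} \<in> E" for v w
      proof -
        have "v \<in> V" "w \<in> V" using edge_vertices[OF assms(1) that] by auto
        moreover have "int (p ^ s) dvd int (k w) * y v + int (k v) * y w"
          using y that unfolding H by blast
        ultimately show ?thesis by (simp only: yx scale)
      qed
      moreover have "x \<in> V \<rightarrow>\<^sub>E {0..<int (p ^ t)}"
        using x_range by (auto simp: x_def)
      ultimately show ?thesis unfolding H by blast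
    qed
    moreover have "y = compose V (coeff_incl p s) x"
    proof
      fix v show "y v = compose V (coeff_incl p s) x v"
      proof (cases "v \<in> V")
        case True
        then show ?thesis using yx incl[OF x_range] by (simp add: compose_def)
      next
        case False
        then show ?thesis using y unfolding H by (auto simp: compose_def PiE_iff extensional_def)
      qed
    qed
    ultimately show "y \<in> ?I" by (auto simp: coeff_incl_image_def s)
  qed
qed

section \<open>Ratios of cocycle values along paths\<close>

text \<open>
  This says \<open>x v / k v \<equiv> \<epsilon> * (x w / k w)\<close> modulo \<open>p\<close> times the local ring of \<open>\<rat>\<close> at \<open>p\<close>, with
  denominators cleared: \<open>c\<close> absorbs the denominators that are units of that ring.
\<close>

definition signed_ratio_cong ::
    "nat \<Rightarrow> ('a \<Rightarrow> nat) \<Rightarrow> ('a \<Rightarrow> int) \<Rightarrow> int \<Rightarrow> 'a \<Rightarrow> 'a \<Rightarrow> bool" where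
  "signed_ratio_cong p k x \<epsilon> v w \<longleftrightarrow>
     (\<exists>c. coprime c (int p) \<and>
       int p * int (k v) * int (k w) dvd c * (x v * int (k w) - \<epsilon> * x w * int (k v)))"

lemma signed_ratio_cong_refl: "signed_ratio_cong p k x 1 v v"
  unfolding signed_ratio_cong_def by (intro exI[of _ 1]) simp

text \<open>
  Two denominators \<open>k u * k v\<close> and \<open>k v * k w\<close> have the common multiple \<open>k u * k v * k w\<close>, over which
  the sum of the two congruences is again divisible by \<open>k v\<close>.
\<close>

lemma signed_ratio_cong_trans:
  assumes "signed_ratio_cong p k x \<epsilon> u v" "signed_ratio_cong p k x \<delta> v w" "0 < k v"
  shows "signed_ratio_cong p k x (\<epsilon> * \<delta>) u w"
proof -
  obtain c d where c: "coprime c (int p)"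
      "int p * int (k u) * int (k v) dvd c * (x u * int (k v) - \<epsilon> * x v * int (k u))"
    and d: "coprime d (int p)"
      "int p * int (k v) * int (k w) dvd d * (x v * int (k w) - \<delta> * x w * int (k v))"
    using assms(1,2) by (auto simp: signed_ratio_cong_def)
  have "int (k v) * (int p * int (k u) * int (k w)) =
        (int p * int (k u) * int (k v)) * int (k w)" by (simp add: algebra_simps)
  also have "\<dots> dvd c * (x u * int (k v) - \<epsilon> * x v * int (k u)) * (d * int (k w))"
    by (rule mult_dvd_mono[OF c(2)]) simp
  finally have 1: "int (k v) * (int p * int (k u) * int (k w))
      dvd c * (x u * int (k v) - \<epsilon> * x v * int (k u)) * (d * int (k w))" .
  have "int (k v) * (int p * int (k u) * int (k w)) =
        (int p * int (k v) * int (k w)) * int (k u)" by (simp add: algebra_simps)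
  also have "\<dots> dvd d * (x v * int (k w) - \<delta> * x w * int (k v)) * (c * \<epsilon> * int (k u))"
    by (rule mult_dvd_mono[OF d(2)]) simp
  finally have 2: "int (k v) * (int p * int (k u) * int (k w))
      dvd d * (x v * int (k w) - \<delta> * x w * int (k v)) * (c * \<epsilon> * int (k u))" .
  have "c * (x u * int (k v) - \<epsilon> * x v * int (k u)) * (d * int (k w))
      + d * (x v * int (k w) - \<delta> * x w * int (k v)) * (c * \<epsilon> * int (k u))
      = int (k v) * (c * d * (x u * int (k w) - \<epsilon> * \<delta> * x w * int (k u)))"
    by (simp add: algebra_simps)
  with dvd_add[OF 1 2]
  have "int p * int (k u) * int (k w) dvd c * d * (x u * int (k w) - \<epsilon> * \<delta> * x w * int (k u))"
    using assms(3) by simp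
  moreover have "coprime (c * d) (int p)" using c d by simp
  ultimately show ?thesis unfolding signed_ratio_cong_def by blast
qed

lemma signed_ratio_cong_sym:
  assumes "signed_ratio_cong p k x \<epsilon> v w" "\<epsilon> * \<epsilon> = 1"
  shows "signed_ratio_cong p k x \<epsilon> w v"
proof -
  obtain c where c: "coprime c (int p)"
      "int p * int (k v) * int (k w) dvd c * (x v * int (k w) - \<epsilon> * x w * int (k v))"
    using assms(1) by (auto simp: signed_ratio_cong_def)
  have "(- \<epsilon>) * (c * (x v * int (k w) - \<epsilon> * x w * int (k v)))
      = c * ((\<epsilon> * \<epsilon>) * x w * int (k v) - \<epsilon> * x v * int (k w))"
    by (simp add: algebra_simps)
  also have "\<dots> = c * (x w * int (k v) - \<epsilon> * x v * int (k w))"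
    by (simp add: assms(2))
  finally have "c * (x w * int (k v) - \<epsilon> * x v * int (k w))
      = (- \<epsilon>) * (c * (x v * int (k w) - \<epsilon> * x w * int (k v)))" ..
  then have "int p * int (k w) * int (k v) dvd c * (x w * int (k v) - \<epsilon> * x v * int (k w))"
    using dvd_mult[OF c(2), of "- \<epsilon>"] by (simp only: mult.assoc mult.commute[of "int (k w)"])
  with c(1) show ?thesis unfolding signed_ratio_cong_def by blast
qed

text \<open>
  Reducedness enters here: the power of \<open>p\<close> in \<open>k v * k w\<close> is smaller than \<open>p^s\<close>, so a factor \<open>p\<close>
  is left after dividing the cocycle condition by \<open>k v * k w\<close>.
\<close>

lemma signed_ratio_cong_edge:
  assumes "Factorial_Ring.prime p" "0 < k v" "0 < k w" "\<not> p ^ s dvd k v * k w"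
    and "int (p ^ s) dvd int (k w) * x v + int (k v) * x w"
  shows "signed_ratio_cong p k x (- 1) v w"
proof -
  have "k v * k w \<noteq> 0" "\<not> is_unit p" using assms(1-3) by auto
  then obtain c where c: "k v * k w = p ^ multiplicity p (k v * k w) * c" "\<not> p dvd c"
    by (rule multiplicity_decompose')
  have "multiplicity p (k v * k w) < s"
    using assms(4) by (metis multiplicity_dvd' not_less)
  then have "p ^ Suc (multiplicity p (k v * k w)) dvd p ^ s"
    by (intro le_imp_power_dvd) simp
  then have "int (p ^ Suc (multiplicity p (k v * k w))) dvd int (k w) * x v + int (k v) * x w"
    using assms(5) by (meson dvd_trans of_nat_dvd_iff)
  then have "int c * int (p ^ Suc (multiplicity p (k v * k w)))
      dvd int c * (x v * int (k w) - (- 1) * x w * int (k v))"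
    by (intro mult_dvd_mono) (simp_all add: algebra_simps)
  moreover have "int p * int (k v) * int (k w) =
      int c * int (p ^ Suc (multiplicity p (k v * k w)))"
    using c(1) by (metis (no_types, lifting) mult.assoc mult.commute of_nat_mult power_Suc)
  moreover have "coprime (int c) (int p)"
    using c(2) assms(1) by (metis coprime_commute coprime_int_iff prime_imp_coprime)
  ultimately show ?thesis unfolding signed_ratio_cong_def by metis
qed

lemma signed_ratio_cong_path:
  assumes ncs: "negative_color_scheme V E k"
    and edge: "\<And>v w. {v, w} \<in> E \<Longrightarrow> signed_ratio_cong p k x (- 1) v w"
    and path: "(u, v) \<in> {(a, b). {a, b} \<in> E}\<^sup>*"
  shows "\<exists>\<epsilon>\<in>{1, - 1}. signed_ratio_cong p k x \<epsilon> u v"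
  using path
proof (induction rule: rtrancl_induct)
  case base
  then show ?case using signed_ratio_cong_refl by (intro bexI[of _ 1]) auto
next
  case (step v w)
  then obtain \<epsilon> where \<epsilon>: "\<epsilon> \<in> {1, - 1}" "signed_ratio_cong p k x \<epsilon> u v" by blast
  have e: "{v, w} \<in> E" using step by simp
  have "0 < k v"
    using ncs edge_vertices[OF _ e] by (auto simp: negative_color_scheme_def)
  then have "signed_ratio_cong p k x (- \<epsilon>) u w"
    using signed_ratio_cong_trans[OF \<epsilon>(2) edge[OF e]] by simp
  then show ?case using \<epsilon>(1) by (intro bexI[of _ "- \<epsilon>"]) auto
qed

lemma cocycle_signed_ratio_cong:
  assumes "Factorial_Ring.prime p" "negative_color_scheme V E k" "mod_reduced E k (p ^ s)"
    and "x \<in> carrier (cohomology0 V E k (integer_mod_group (p ^ s)))" and e: "{v, w} \<in> E"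
  shows "signed_ratio_cong p k x (- 1) v w"
proof (rule signed_ratio_cong_edge[OF assms(1)])
  have g: "finite_simple_graph V E" and "\<forall>v\<in>V. 0 < k v"
    using assms(2) by (auto simp: negative_color_scheme_def)
  then show "0 < k v" "0 < k w" using edge_vertices[OF g e] by auto
  show "\<not> p ^ s dvd k v * k w"
    using assms(3) e by (auto simp: mod_reduced_def cong_0_iff)
  have "0 < p ^ s" using assms(1) by (simp add: prime_gt_0_nat)
  then show "int (p ^ s) dvd int (k w) * x v + int (k v) * x w"
    using assms(4) e carrier_cohomology0[OF g] by blast
qed

section \<open>Reduction of cocycles modulo \<open>p\<close>\<close>

text \<open>
  Since \<open>g\<close> divides \<open>k v\<close> and \<open>k w / g\<close> is prime to \<open>p\<close>, the quotient \<open>k v / k w\<close> is integral at \<open>p\<close>;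
  multiplying the congruence of ratios by \<open>k v\<close> gives \<open>x v \<equiv> \<epsilon> * (k v / k w) * x w (mod p)\<close>.
\<close>

lemma dvd_transfer_from_minimal:
  assumes p: "Factorial_Ring.prime p" and cong: "signed_ratio_cong p k x \<epsilon> v w"
    and k: "0 < k v" "g dvd k v" "g dvd k w" "\<not> p dvd k w div g" and x: "int p dvd x w"
  shows "int p dvd x v"
proof -
  obtain a b where ab: "k v = g * a" "k w = g * b" using k by (auto elim!: dvdE)
  have "g \<noteq> 0" using k(1) ab by auto
  obtain c where c: "coprime c (int p)"
      "int p * int (k v) * int (k w) dvd c * (x v * int (k w) - \<epsilon> * x w * int (k v))"
    using cong by (auto simp: signed_ratio_cong_def)
  have "int g * int p dvd int p * int (k v) * int (k w)" by (simp add: ab)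
  also note c(2)
  also have "c * (x v * int (k w) - \<epsilon> * x w * int (k v))
      = int g * (c * (x v * int b - \<epsilon> * x w * int a))"
    by (simp add: ab algebra_simps)
  finally have "int p dvd c * (x v * int b - \<epsilon> * x w * int a)" using \<open>g \<noteq> 0\<close> by simp
  then have diff: "int p dvd x v * int b - \<epsilon> * x w * int a"
    using c(1) by (metis coprime_commute coprime_dvd_mult_right_iff)
  have "int p dvd \<epsilon> * x w * int a" using x by simp
  with diff have "int p dvd x v * int b" by (metis dvd_add diff_add_cancel)
  moreover have "\<not> p dvd b" using k(4) ab \<open>g \<noteq> 0\<close> by simp
  ultimately show ?thesis
    using p by (simp add: prime_dvd_mult_iff)
qed

lemma cocycle_dvd_everywhere:
  assumes p: "Factorial_Ring.prime p" and ncs: "negative_color_scheme V E k"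
    and conn: "connected_graph V E" and red: "mod_reduced E k (p ^ s)"
    and x: "x \<in> carrier (cohomology0 V E k (integer_mod_group (p ^ s)))"
    and w: "w \<in> V" "\<not> p dvd k w div Gcd (k ` V)" "int p dvd x w" and v: "v \<in> V"
  shows "int p dvd x v"
proof -
  have "(v, w) \<in> {(a, b). {a, b} \<in> E}\<^sup>*" using conn v w(1) by (simp add: connected_graph_def)
  then obtain \<epsilon> where "signed_ratio_cong p k x \<epsilon> v w"
    using signed_ratio_cong_path[OF ncs cocycle_signed_ratio_cong[OF p ncs red x]] by blast
  moreover have "0 < k v" using ncs v by (simp add: negative_color_scheme_def)
  ultimately show ?thesis
    using dvd_transfer_from_minimal[OF p, of k x \<epsilon> v w "Gcd (k ` V)"] v w by simp
qed

text \<open>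
  The bipartitioning sends \<open>v\<close> to the sign relating the ratios at \<open>u\<close> and \<open>v\<close>.  It is well defined
  because \<open>2 * x u\<close> is prime to \<open>p\<close>, and it changes along every edge because edges carry the sign
  \<open>- 1\<close>.
\<close>

lemma bipartite_if_cocycle_not_dvd:
  assumes p: "Factorial_Ring.prime p" "odd p" and ncs: "negative_color_scheme V E k"
    and conn: "connected_graph V E" and red: "mod_reduced E k (p ^ s)"
    and x: "x \<in> carrier (cohomology0 V E k (integer_mod_group (p ^ s)))"
    and u: "u \<in> V" "\<not> int p dvd x u"
  shows "bipartite V E"
proof -
  note edge = cocycle_signed_ratio_cong[OF p(1) ncs red x]
  have g: "finite_simple_graph V E" and pos: "\<And>v. v \<in> V \<Longrightarrow> 0 < k v"
    using ncs by (auto simp: negative_color_scheme_def)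
  have some_sign: "\<exists>\<epsilon>\<in>{1, - 1}. signed_ratio_cong p k x \<epsilon> u v" if "v \<in> V" for v
  proof -
    have "(u, v) \<in> {(a, b). {a, b} \<in> E}\<^sup>*"
      using conn that u(1) by (simp add: connected_graph_def)
    then show ?thesis using signed_ratio_cong_path[OF ncs edge] by blast
  qed
  have not_both: False
    if v: "v \<in> V" and "signed_ratio_cong p k x 1 u v" "signed_ratio_cong p k x (- 1) u v" for v
  proof -
    \<comment> \<open>Going to \<open>v\<close> with one sign and back with the other gives \<open>2 * x u \<equiv> 0\<close>.\<close>
    have "signed_ratio_cong p k x (- 1) u u"
      using signed_ratio_cong_trans[OF that(2) signed_ratio_cong_sym[OF that(3)] pos[OF v]] by simp
    then obtain c where c: "coprime c (int p)"
      "int p * int (k u) * int (k u) dvd c * (x u * int (k u) - (- 1) * x u * int (k u))"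
      by (auto simp: signed_ratio_cong_def)
    have "c * (x u * int (k u) - (- 1) * x u * int (k u)) = (c * 2 * x u) * int (k u)"
      by (simp add: algebra_simps)
    with c(2) have "int p * int (k u) dvd c * (2 * x u)" using pos[OF u(1)] by (simp add: mult.assoc)
    then have "int p dvd c * (2 * x u)" by (rule dvd_mult_left)
    then have "int p dvd 2 * x u"
      using c(1) by (metis coprime_commute coprime_dvd_mult_right_iff)
    moreover have "coprime (int p) 2" using p(2) by simp
    ultimately show False using u(2) by (metis coprime_dvd_mult_right_iff)
  qed
  define \<alpha> where "\<alpha> v = (if signed_ratio_cong p k x 1 u v then 1 else - 1 :: int)" for v
  have \<alpha>: "signed_ratio_cong p k x (\<alpha> v) u v" if "v \<in> V" for v
    using some_sign[OF that] by (auto simp: \<alpha>_def)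
  have "\<alpha> v \<noteq> \<alpha> w" if e: "{v, w} \<in> E" for v w
  proof
    assume eq: "\<alpha> v = \<alpha> w"
    have V: "v \<in> V" "w \<in> V" using edge_vertices[OF g e] by auto
    have "signed_ratio_cong p k x (- \<alpha> v) u w"
      using signed_ratio_cong_trans[OF \<alpha>[OF V(1)] edge[OF e] pos[OF V(1)]] by simp
    moreover have "\<alpha> v = 1 \<or> \<alpha> v = - 1" by (simp add: \<alpha>_def)
    ultimately show False using \<alpha>[OF V(2)] not_both[OF V(2)] eq by auto
  qed
  then have "bipartitioning V E \<alpha>" by (auto simp: bipartitioning_def \<alpha>_def)
  then show ?thesis by (auto simp: bipartite_def)
qed

section \<open>Orientation classes\<close>

text \<open>
  A homomorphism whose value at \<open>c\<close> generates the target is onto, so the first isomorphism theorem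
  applies, and the coset of \<open>c\<close> generates the quotient.
\<close>

lemma (in group_hom) quotient_generated_by_coset:
  assumes c: "c \<in> carrier G" and gen: "generate H {h c} = carrier H"
  shows "G Mod kernel G H h \<cong> H"
    and "generate (G Mod kernel G H h) {kernel G H h #>\<^bsub>G\<^esub> c} = carrier (G Mod kernel G H h)"
proof -
  let ?K = "kernel G H h"
  interpret K: normal ?K G by (rule normal_kernel)
  interpret Q: group "G Mod ?K" by (rule K.factorgroup_is_group)
  have powers: "\<exists>n::int. y = h (c [^] n)" if "y \<in> carrier H" for y
    using that gen c H.generate_pow[of "h c"] by (auto simp: hom_int_pow)
  have "h ` carrier G = carrier H"
    using powers c by (blast intro: G.int_pow_closed hom_closed)
  then show "G Mod ?K \<cong> H" by (rule FactGroup_iso)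
  have cQ: "?K #> c \<in> carrier (G Mod ?K)" using c by (auto simp: carrier_FactGroup)
  have "carrier (G Mod ?K) \<subseteq> generate (G Mod ?K) {?K #> c}"
  proof
    fix A assume "A \<in> carrier (G Mod ?K)"
    then obtain x where x: "x \<in> carrier G" "A = ?K #> x" by (auto simp: carrier_FactGroup)
    obtain n :: int where n: "h x = h (c [^] n)"
      using powers[OF hom_closed[OF x(1)]] by blast
    have cn: "c [^] n \<in> carrier G" using c by simp
    have "h (x \<otimes> inv (c [^] n)) = h x \<otimes>\<^bsub>H\<^esub> inv\<^bsub>H\<^esub> h (c [^] n)"
      using x(1) cn by (simp only: hom_mult hom_inv G.inv_closed)
    also have "\<dots> = \<one>\<^bsub>H\<^esub>" unfolding n by (rule H.r_inv[OF hom_closed[OF cn]])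
    finally have "x \<otimes> inv (c [^] n) \<in> ?K" using x(1) cn unfolding kernel_def by blast
    then have "x \<in> ?K #> (c [^] n)"
      by (rule K.rcos_module_rev[OF G.is_group cn x(1)])
    then have "A = ?K #> (c [^] n)"
      unfolding x(2) by (rule G.repr_independence[OF _ cn K.subgroup_axioms, symmetric])
    then show "A \<in> generate (G Mod ?K) {?K #> c}"
      using K.FactGroup_int_pow[OF c] Q.generate_pow[OF cQ] by auto
  qed
  then show "generate (G Mod ?K) {?K #> c} = carrier (G Mod ?K)"
    using Q.generate_incl[of "{?K #> c}"] cQ by blast
qed

lemma generate_one_integer_mod_group:
  assumes "1 < n"
  shows "generate (integer_mod_group n) {1} = carrier (integer_mod_group n)"
proof -
  have "{1 [^]\<^bsub>integer_mod_group n\<^esub> m | m :: int. m \<in> UNIV} = {0..<int n}"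
  proof (intro equalityI subsetI)
    fix y :: int assume "y \<in> {0..<int n}"
    then show "y \<in> {1 [^]\<^bsub>integer_mod_group n\<^esub> m | m :: int. m \<in> UNIV}"
      by (auto simp: int_pow_integer_mod_group intro!: exI[of _ y])
  qed (use assms in \<open>auto simp: int_pow_integer_mod_group\<close>)
  then show ?thesis
    using group.generate_pow[OF group_integer_mod_group, of 1 n] assms
    by (simp add: carrier_integer_mod_group)
qed

lemma exists_vertex_not_dvd_div_Gcd:
  assumes "\<And>v. v \<in> V \<Longrightarrow> 0 < k v" "V \<noteq> {}" "\<not> is_unit (p :: nat)"
  shows "\<exists>w\<in>V. \<not> p dvd k w div Gcd (k ` V)"
proof (rule ccontr)
  assume "\<not> ?thesis"
  then have *: "p dvd k v div Gcd (k ` V)" if "v \<in> V" for v using that by auto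
  have "p * Gcd (k ` V) dvd Gcd (k ` V)"
  proof (rule Gcd_greatest)
    fix a assume "a \<in> k ` V"
    then obtain v where v: "v \<in> V" "a = k v" by blast
    have "p * Gcd (k ` V) dvd (k v div Gcd (k ` V)) * Gcd (k ` V)"
      using *[OF v(1)] by (rule mult_dvd_mono) simp
    then show "p * Gcd (k ` V) dvd a" using v by simp
  qed
  moreover have "Gcd (k ` V) \<noteq> 0"
  proof
    assume "Gcd (k ` V) = 0"
    then have "\<forall>v\<in>V. k v = 0" by (auto simp: Gcd_0_iff)
    with assms(1,2) show False by fastforce
  qed
  ultimately show False using assms(3) by simp
qed

lemma Gcd_mult_divided_fundamental_class:
  assumes "v \<in> V"
  shows "int (Gcd (k ` V)) * divided_fundamental_class V k \<alpha> v = \<alpha> v * int (k v)"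
proof -
  have "int (Gcd (k ` V)) dvd \<alpha> v * int (k v)" using assms by simp
  then show ?thesis using assms by (simp add: divided_fundamental_class_def)
qed

lemma divided_fundamental_class_cocycle:
  assumes g: "finite_simple_graph V E" "0 < n" and \<alpha>: "bipartitioning V E \<alpha>"
  shows "reduce_cochain V n (divided_fundamental_class V k \<alpha>)
         \<in> carrier (cohomology0 V E k (integer_mod_group n))" (is "?c \<in> _")
proof -
  let ?d = "divided_fundamental_class V k \<alpha>"
  note d = Gcd_mult_divided_fundamental_class[of _ V k \<alpha>]
  have "int n dvd int (k w) * ?c v + int (k v) * ?c w" if e: "{v, w} \<in> E" for v w
  proof -
    have V: "v \<in> V" "w \<in> V" using edge_vertices[OF g(1) e] by auto
    have "\<alpha> v \<in> {1, -1}" "\<alpha> w \<in> {1, -1}" "\<alpha> v \<noteq> \<alpha> w"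
      using \<alpha> V e unfolding bipartitioning_def Pi_iff by blast+
    then have sgn: "\<alpha> v + \<alpha> w = 0" by auto
    have "int (Gcd (k ` V)) * (int (k w) * ?d v + int (k v) * ?d w)
        = int (k w) * (\<alpha> v * int (k v)) + int (k v) * (\<alpha> w * int (k w))"
      using d[OF V(1)] d[OF V(2)] by (simp add: algebra_simps)
    also have "\<dots> = int (k v) * int (k w) * (\<alpha> v + \<alpha> w)" by (simp add: algebra_simps)
    finally have "Gcd (k ` V) = 0 \<or> int (k w) * ?d v + int (k v) * ?d w = 0"
      by (simp add: sgn)
    moreover have "k v = 0 \<and> k w = 0" if "Gcd (k ` V) = 0"
      using that V by (auto simp: Gcd_0_iff)
    ultimately have "int n dvd int (k w) * ?d v + int (k v) * ?d w" by auto
    then show ?thesis using V by (simp add: reduce_cochain_def compose_def dvd_linear_mod_iff)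
  qed
  moreover have "?c \<in> V \<rightarrow>\<^sub>E {0..<int n}"
    using g(2) by (auto simp: reduce_cochain_def compose_def)
  ultimately show ?thesis using carrier_cohomology0[OF g] by blast
qed

lemma orientation_class_divided_fundamental_class:
  assumes p: "Factorial_Ring.prime p" and s: "1 \<le> s" and ncs: "negative_color_scheme V E k"
    and conn: "connected_graph V E" and red: "mod_reduced E k (p ^ s)"
    and \<alpha>: "bipartitioning V E \<alpha>"
  shows "orientation_class V E k p s
           (reduce_cochain V (p ^ s) (divided_fundamental_class V k \<alpha>))"
proof -
  let ?H = "cohomology0 V E k (integer_mod_group (p ^ s))"
  let ?Z = "integer_mod_group p"
  define c where "c = reduce_cochain V (p ^ s) (divided_fundamental_class V k \<alpha>)"
  have g: "finite_simple_graph V E" and pos: "\<And>v. v \<in> V \<Longrightarrow> 0 < k v"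
    using ncs by (auto simp: negative_color_scheme_def)
  have p0: "0 < p" "1 < p" "0 < p ^ s" and ps: "int p dvd int (p ^ s)"
    using p s prime_gt_1_nat[OF p] by (auto intro: dvd_power simp: prime_gt_0_nat)
  have cH: "c \<in> carrier ?H"
    unfolding c_def by (rule divided_fundamental_class_cocycle[OF g p0(3) \<alpha>])
  have "V \<noteq> {}" "\<not> is_unit p" using conn p by (auto simp: connected_graph_def)
  from exists_vertex_not_dvd_div_Gcd[of V k, OF pos this]
  obtain w where w: "w \<in> V" "\<not> p dvd k w div Gcd (k ` V)" by blast
  have cw: "\<not> int p dvd c w"
  proof -
    obtain b where b: "k w = Gcd (k ` V) * b" using w(1) by (meson Gcd_dvd dvdE image_eqI)
    have gcd0: "Gcd (k ` V) \<noteq> 0" using b pos[OF w(1)] by (metis mult_0 less_not_refl)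
    have "\<not> p dvd b" using w(2) gcd0 by (subst (asm) b) simp
    moreover have "divided_fundamental_class V k \<alpha> w = \<alpha> w * int b"
    proof -
      have "int (Gcd (k ` V)) * divided_fundamental_class V k \<alpha> w
          = int (Gcd (k ` V)) * (\<alpha> w * int b)"
        unfolding Gcd_mult_divided_fundamental_class[OF w(1)]
        by (metis b mult.left_commute of_nat_mult)
      then show ?thesis using gcd0 by (metis mult_left_cancel of_nat_eq_0_iff)
    qed
    moreover have "\<alpha> w \<in> {1, -1}" using \<alpha> w(1) unfolding bipartitioning_def Pi_iff by blast
    ultimately have "\<not> int p dvd divided_fundamental_class V k \<alpha> w" by auto
    then show ?thesis
      using w(1) ps by (simp add: c_def reduce_cochain_def compose_def dvd_mod_iff)
  qed
  \<comment> \<open>Scaling evaluation at \<open>w\<close> by an inverse of \<open>c w\<close> sends \<open>c\<close> to the generator \<open>1\<close>.\<close>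
  obtain a where a: "[c w * a = 1] (mod int p)"
    using cw p by (meson cong_solve_coprime_int coprime_commute prime_imp_coprime prime_nat_int_transfer)
  have a_unit: "coprime a (int p)"
    using a by (metis cong_imp_coprime cong_sym coprime_1_left coprime_mult_left_iff)
  define \<phi> where "\<phi> x = x w * a mod int p" for x :: "'a \<Rightarrow> int"
  have \<phi>c: "\<phi> c = 1" using a p0(2) by (simp add: \<phi>_def cong_def)
  have "\<phi> (x \<otimes>\<^bsub>?H\<^esub> y) = \<phi> x \<otimes>\<^bsub>?Z\<^esub> \<phi> y" for x y
  proof -
    have "[(x w + y w) mod int (p ^ s) = x w + y w] (mod int p)"
      using ps by (simp add: cong_def mod_mod_cancel)
    then have "[(x w + y w) mod int (p ^ s) * a = x w * a + y w * a] (mod int p)"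
      unfolding distrib_right[symmetric] by (rule cong_scalar_right)
    then show ?thesis using w(1) by (simp add: \<phi>_def cong_def mod_add_eq)
  qed
  then have "\<phi> \<in> hom ?H ?Z"
    using p0 by (auto simp: hom_def \<phi>_def carrier_integer_mod_group)
  then interpret group_hom ?H ?Z \<phi>
    using group_cohomology0[OF g p0(3)] by (simp add: group_hom_def group_hom_axioms_def)
  have "\<phi> x = 0 \<longleftrightarrow> int p dvd x w" for x
    unfolding \<phi>_def using a_unit
    by (metis coprime_commute coprime_dvd_mult_left_iff mod_eq_0_iff_dvd)
  then have ker: "coeff_incl_image V E k p s = kernel ?H ?Z \<phi>"
    using cocycle_dvd_everywhere[OF p ncs conn red _ w] w(1)
    by (auto simp: coeff_incl_image_eq[OF g p0(1) s] kernel_def)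
  have gen: "generate ?Z {\<phi> c} = carrier ?Z"
    using generate_one_integer_mod_group[OF p0(2)] by (simp add: \<phi>c)
  show ?thesis
    using quotient_generated_by_coset[OF cH gen] conn cH
    by (simp add: orientation_class_def mod_oriented_def critical_cohomology_def ker c_def)
qed

lemma not_mod_oriented_if_not_bipartite:
  assumes p: "Factorial_Ring.prime p" "odd p" and s: "1 \<le> s"
    and ncs: "negative_color_scheme V E k"
    and conn: "connected_graph V E" and red: "mod_reduced E k (p ^ s)"
    and nb: "\<not> bipartite V E"
  shows "\<not> mod_oriented V E k p s"
proof
  assume "mod_oriented V E k p s"
  let ?H = "cohomology0 V E k (integer_mod_group (p ^ s))"
  have g: "finite_simple_graph V E" using ncs by (simp add: negative_color_scheme_def)
  have p0: "0 < p" "1 < p" "0 < p ^ s" using prime_gt_1_nat[OF p(1)] by auto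
  interpret group ?H by (rule group_cohomology0[OF g p0(3)])
  have "coeff_incl_image V E k p s = carrier ?H"
    using bipartite_if_cocycle_not_dvd[OF p ncs conn red] nb
    by (auto simp: coeff_incl_image_eq[OF g p0(1) s])
  then have "carrier (critical_cohomology V E k p s) = (\<lambda>x. carrier ?H #>\<^bsub>?H\<^esub> x) ` carrier ?H"
    by (simp add: critical_cohomology_def carrier_FactGroup)
  also have "\<dots> = {carrier ?H}"
    using coset_join2[OF _ subgroup_self] one_closed by (auto simp: image_iff intro!: bexI[of _ "\<one>\<^bsub>?H\<^esub>"])
  finally have "card (carrier (critical_cohomology V E k p s)) = 1" by simp
  moreover have "card (carrier (critical_cohomology V E k p s)) = card (carrier (integer_mod_group p))"
    using \<open>mod_oriented V E k p s\<close>
    by (auto simp: mod_oriented_def is_iso_def iso_def intro: bij_betw_same_card)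
  ultimately show False using p0 by (simp add: carrier_integer_mod_group)
qed

theorem lemma16:
  fixes V :: "'a set" and E :: "'a set set" and k :: "'a \<Rightarrow> nat" and p s :: nat
  assumes "Factorial_Ring.prime p" and "1 \<le> s"
    and "negative_color_scheme V E k"
    and "connected_graph V E"
    and "mod_reduced E k (p ^ s)"
  shows "(\<forall>\<alpha>. bipartitioning V E \<alpha> \<longrightarrow>
            orientation_class V E k p s
              (reduce_cochain V (p ^ s) (divided_fundamental_class V k \<alpha>)))
       \<and> (odd p \<and> \<not> bipartite V E \<longrightarrow> \<not> mod_oriented V E k p s)"
  using orientation_class_divided_fundamental_class[OF assms]
    not_mod_oriented_if_not_bipartite[OF assms(1) _ assms(2-5)] by blast

end
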